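(* Let $n>1$, let $\|\cdot\|$ be a norm on $\mathbb{R}^n$, let $\mathcal{S}$ be an $n$-simplex in $\mathbb{R}^n$ with vertices $A_1,\dots,A_{n+1}$, and let $v\in C^2(\mathcal{S})$ be real-valued. Let $\pi_{\mathcal{S}}(v)$ be the polynomial of degree at most one which interpolates $v$ at the vertices $A_1,\dots,A_{n+1}$. Then the two following interpolation error estimates hold: $$\forall P\in\mathcal{S}:\quad |\pi_{\mathcal{S}}(v)(P)-v(P)|\le\frac{\|D^2(v)\|_\infty}{2}\,\mathrm{diam}(\mathcal{S})^2,$$ $$\forall P\in\mathcal{S}:\quad |\pi_{\mathcal{S}}(v)(P)-v(P)|\le\frac{\|D(v)\|_\infty}{2}\,\mathrm{diam}(\mathcal{S})+\frac{\|D^2(v)\|_\infty}{4}\,\mathrm{diam}(\mathcal{S})^2.$$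
   Context: The polynomial is $\pi_{\mathcal{S}}(v)(P)=\sum_{i=1}^{n+1}\lambda_i(P)v(A_i)$, where $\lambda_i$ are the barycentric functions of $\mathcal{S}$: $\sum_i\lambda_i(P)\,OA_i=OP$ and $\sum_i\lambda_i(P)=1$, $O$ being the origin. The diameter $\mathrm{diam}(\mathcal{S})$ is the greatest distance (for $\|\cdot\|$) between two points of $\mathcal{S}$. $D(v)(P)$ and $D^2(v)(P)$ are the first and second differentials of $v$ at $P$ (a linear form and a symmetric bilinear form on $\mathbb{R}^n$), with operator norms $|||D(v)(P)|||=\sup_{h\ne0}\frac{|Dv(P).(h)|}{\|h\|}$ and $|||D^2(v)(P)|||=\sup_{h,h'\ne0}\frac{|D^2v(P).(h,h')|}{\|h\|\,\|h'\|}$. For a field $L$ of $p$-linear forms on $\bar{\mathcal{S}}$, $\|L\|_\infty=\sup_{P\in\bar{\mathcal{S}}}|||L(P)|||$. *)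

theory Defs
  imports "HOL-Analysis.Analysis"
begin

text \<open>An arbitrary norm on \<open>\<real>\<^sup>n\<close>, unrelated to the Euclidean \<open>norm\<close> of the type class.\<close>

definition is_norm :: "(real^'n \<Rightarrow> real) \<Rightarrow> bool" where
  "is_norm N \<longleftrightarrow>
     (\<forall>x. 0 \<le> N x) \<and> (\<forall>x. N x = 0 \<longleftrightarrow> x = 0) \<and>
     (\<forall>c x. N (c *\<^sub>R x) = \<bar>c\<bar> * N x) \<and> (\<forall>x y. N (x + y) \<le> N x + N y)"

text \<open>The real-valued suprema below are taken over sets that are nonempty and bounded above
  whenever \<open>N\<close> is a norm, \<open>S\<close> is nonempty and compact, the forms are (bi)linear and the fields
  of forms are continuous on \<open>S\<close>.\<close>

definition diam :: "(real^'n \<Rightarrow> real) \<Rightarrow> (real^'n) set \<Rightarrow> real" where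
  "diam N S = (SUP (P, Q) \<in> S \<times> S. N (P - Q))"

definition opnorm1 :: "(real^'n \<Rightarrow> real) \<Rightarrow> (real^'n \<Rightarrow> real) \<Rightarrow> real" where
  "opnorm1 N L = (SUP h \<in> {h. h \<noteq> 0}. \<bar>L h\<bar> / N h)"

definition opnorm2 :: "(real^'n \<Rightarrow> real) \<Rightarrow> (real^'n \<Rightarrow> real^'n \<Rightarrow> real) \<Rightarrow> real" where
  "opnorm2 N B = (SUP (h, h') \<in> {h. h \<noteq> 0} \<times> {h'. h' \<noteq> 0}. \<bar>B h h'\<bar> / (N h * N h'))"

definition supnorm1 ::
    "(real^'n \<Rightarrow> real) \<Rightarrow> (real^'n) set \<Rightarrow> (real^'n \<Rightarrow> ((real^'n) \<Rightarrow>\<^sub>L real)) \<Rightarrow> real" where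
  "supnorm1 N S L = (SUP P \<in> closure S. opnorm1 N (\<lambda>h. blinfun_apply (L P) h))"

definition supnorm2 ::
    "(real^'n \<Rightarrow> real) \<Rightarrow> (real^'n) set \<Rightarrow> (real^'n \<Rightarrow> ((real^'n) \<Rightarrow>\<^sub>L ((real^'n) \<Rightarrow>\<^sub>L real))) \<Rightarrow> real" where
  "supnorm2 N S B =
     (SUP P \<in> closure S. opnorm2 N (\<lambda>h h'. blinfun_apply (blinfun_apply (B P) h) h'))"

text \<open>\<open>v\<close> is of class $C^2$ on \<open>S\<close>, with first and second differentials \<open>Dv\<close> and \<open>D2v\<close>.
  Differentials are taken relative to \<open>S\<close>, so that nothing is required of \<open>v\<close> outside \<open>S\<close>;
  on a convex set with nonempty interior (such as a full-dimensional simplex) they are uniquely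
  determined on \<open>S\<close>, also at boundary points, and agree with the ordinary ones if \<open>v\<close> extends
  to a $C^2$ function on a neighbourhood of \<open>S\<close>.\<close>

definition C2_on ::
    "(real^'n) set \<Rightarrow> (real^'n \<Rightarrow> real) \<Rightarrow> (real^'n \<Rightarrow> ((real^'n) \<Rightarrow>\<^sub>L real)) \<Rightarrow>
     (real^'n \<Rightarrow> ((real^'n) \<Rightarrow>\<^sub>L ((real^'n) \<Rightarrow>\<^sub>L real))) \<Rightarrow> bool" where
  "C2_on S v Dv D2v \<longleftrightarrow>
     (\<forall>P\<in>S. (v has_derivative blinfun_apply (Dv P)) (at P within S)) \<and>
     (\<forall>P\<in>S. (Dv has_derivative blinfun_apply (D2v P)) (at P within S)) \<and>
     continuous_on S D2v"

text \<open>Vertices are \<open>A 1, \<dots>, A (n + 1)\<close> with \<open>n = CARD('n)\<close>. Injectivity of the indexing is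
  needed because \<open>affine_dependent\<close> speaks about the set of vertices.\<close>

definition simplex_vertices :: "(nat \<Rightarrow> real^'n) \<Rightarrow> bool" where
  "simplex_vertices A \<longleftrightarrow>
     inj_on A {1..CARD('n) + 1} \<and> \<not> affine_dependent (A ` {1..CARD('n) + 1})"

text \<open>For the vertices of a simplex the choice is unique on the indices \<open>1, \<dots>, n + 1\<close>,
  and a suitable \<open>l\<close> exists for every point \<open>P\<close> of the space.\<close>

definition barycentric :: "(nat \<Rightarrow> real^'n) \<Rightarrow> nat \<Rightarrow> real^'n \<Rightarrow> real" where
  "barycentric A i P =
     (SOME l. (\<Sum>j = 1..CARD('n) + 1. l j *\<^sub>R A j) = P \<and> (\<Sum>j = 1..CARD('n) + 1. l j) = 1) i"

definition interpolant :: "(nat \<Rightarrow> real^'n) \<Rightarrow> (real^'n \<Rightarrow> real) \<Rightarrow> real^'n \<Rightarrow> real" where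
  "interpolant A v P = (\<Sum>i = 1..CARD('n) + 1. barycentric A i P * v (A i))"

end

theory Submission
  imports Defs
begin

text \<open>
  Barycentric coordinates of a point \<open>P\<close> of the simplex are nonnegative and add up to one, so
  \[ \pi(v)(P) - v(P) = \sum_i \lambda_i(P)\, \bigl(v(A_i) - v(P)\bigr) \]
  is a weighted mean of the increments of \<open>v\<close> from \<open>P\<close> to the vertices. Since
  \<open>\<Sum>\<^sub>i \<lambda>\<^sub>i(P) (A\<^sub>i - P) = 0\<close>, the linear form \<open>Dv(P)\<close> may be subtracted from each increment
  without changing the mean. With \<open>d\<close> the diameter and \<open>M\<^sub>1\<close>, \<open>M\<^sub>2\<close> the norms of the two
  differentials, this gives two bounds:

  \<^item> first-order Taylor expansion along the segments from \<open>P\<close> to the \<open>A\<^sub>i\<close>, which stay inside the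
    convex set \<open>S\<close>, bounds each corrected increment by \<open>M\<^sub>2 d\<^sup>2 / 2\<close>;
  \<^item> the mean value theorem bounds each plain increment by \<open>M\<^sub>1 d\<close>.

  The first bound is the first estimate, and the arithmetic mean of the two bounds is the second.
  Both are pure segment arguments, in \<open>expansion_remainder_bound\<close> and
  \<open>increment_bound\<close>. What remains is to know that the real suprema behind \<open>d\<close>, \<open>M\<^sub>1\<close> and
  \<open>M\<^sub>2\<close> are genuine upper bounds. They are because the arbitrary norm is equivalent to the
  Euclidean one and \<open>S\<close> is compact.
\<close>

section \<open>Arbitrary norms on a finite-dimensional space\<close>

lemma is_norm_pos:
  assumes "is_norm N" "x \<noteq> 0"
  shows "N x > 0"
  using assms unfolding is_norm_def by (metis less_eq_real_def)

lemma is_norm_zero: "is_norm N \<Longrightarrow> N 0 = 0"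
  unfolding is_norm_def by blast

lemma is_norm_sum_le:
  assumes "is_norm N" "finite I"
  shows "N (\<Sum>i\<in>I. f i) \<le> (\<Sum>i\<in>I. N (f i))"
  using assms(2)
proof (induction I rule: finite_induct)
  case empty
  then show ?case using is_norm_zero[OF assms(1)] by simp
next
  case (insert x F)
  have "N (f x + sum f F) \<le> N (f x) + N (sum f F)"
    using assms(1) unfolding is_norm_def by blast
  then show ?case using insert by simp
qed

lemma is_norm_upper:
  fixes N :: "real^'n \<Rightarrow> real"
  assumes "is_norm N"
  obtains C where "C \<ge> 0" "\<And>x. N x \<le> C * norm x"
proof
  let ?C = "\<Sum>b\<in>(Basis :: (real^'n) set). N b"
  have hom: "N (c *\<^sub>R x) = \<bar>c\<bar> * N x" and nn: "0 \<le> N x" for c x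
    using assms unfolding is_norm_def by blast+
  show "?C \<ge> 0" by (simp add: sum_nonneg nn)
  fix x :: "real^'n"
  have "N x = N (\<Sum>b\<in>Basis. (x \<bullet> b) *\<^sub>R b)" by (simp add: euclidean_representation)
  also have "\<dots> \<le> (\<Sum>b\<in>Basis. N ((x \<bullet> b) *\<^sub>R b))"
    by (rule is_norm_sum_le[OF assms]) simp
  also have "\<dots> \<le> (\<Sum>b\<in>Basis. norm x * N b)"
    by (intro sum_mono) (simp add: hom mult_right_mono nn Basis_le_norm)
  finally show "N x \<le> ?C * norm x" by (simp add: sum_distrib_left mult.commute)
qed

lemma is_norm_continuous:
  fixes N :: "real^'n \<Rightarrow> real"
  assumes "is_norm N"
  shows "continuous_on UNIV N"
proof -
  obtain C where C: "C \<ge> 0" "\<And>x. N x \<le> C * norm x"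
    using is_norm_upper[OF assms] by blast
  have tri: "N (x + y) \<le> N x + N y" for x y using assms unfolding is_norm_def by blast
  have "\<bar>N x - N y\<bar> \<le> C * dist x y" for x y
    using tri[of y "x - y"] tri[of x "y - x"] C(2)[of "x - y"] C(2)[of "y - x"]
    by (simp add: dist_norm norm_minus_commute)
  then have "C-lipschitz_on UNIV N"
    by (intro lipschitz_onI) (use C(1) in \<open>auto simp: dist_real_def\<close>)
  then show ?thesis by (rule lipschitz_on_continuous_on)
qed

text \<open>By homogeneity, the constant is the minimum of \<open>N\<close> on the compact Euclidean unit sphere.\<close>

lemma is_norm_lower:
  fixes N :: "real^'n \<Rightarrow> real"
  assumes "is_norm N"
  obtains c where "c > 0" "\<And>x. c * norm x \<le> N x"
proof -
  obtain e where e: "norm e = 1" "\<And>y. norm y = 1 \<Longrightarrow> N e \<le> N y"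
    using continuous_attains_inf[of "sphere 0 1 :: (real^'n) set" N]
      continuous_on_subset[OF is_norm_continuous[OF assms]]
    by auto
  have "N e * norm x \<le> N x" for x
  proof (cases "x = 0")
    case True
    then show ?thesis using is_norm_zero[OF assms] by simp
  next
    case False
    have "N e \<le> N ((1 / norm x) *\<^sub>R x)" using False by (intro e(2)) simp
    also have "\<dots> = N x / norm x"
      using assms unfolding is_norm_def by (simp add: divide_inverse mult.commute)
    finally show ?thesis using False by (simp add: field_simps)
  qed
  moreover have "N e > 0" using e(1) by (intro is_norm_pos[OF assms]) auto
  ultimately show ?thesis using that by blast
qed

section \<open>The suprema are upper bounds\<close>

lemma diam_ge:
  fixes N :: "real^'n \<Rightarrow> real"
  assumes "is_norm N" "compact S" "P \<in> S" "Q \<in> S"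
  shows "N (P - Q) \<le> diam N S"
proof -
  have "continuous_on (S \<times> S) (\<lambda>x. N (fst x - snd x))"
    by (rule continuous_on_compose2[OF is_norm_continuous[OF assms(1)]])
       (auto intro!: continuous_intros)
  then have "bdd_above ((\<lambda>x. N (fst x - snd x)) ` (S \<times> S))"
    using assms(2) by (intro bounded_imp_bdd_above compact_imp_bounded
        compact_continuous_image compact_Times)
  then have "N (fst (P, Q) - snd (P, Q)) \<le> (SUP x\<in>S \<times> S. N (fst x - snd x))"
    by (intro cSUP_upper) (use assms in auto)
  then show ?thesis by (simp add: diam_def case_prod_beta)
qed

lemma linear_form_bound:
  fixes L :: "(real^'n) \<Rightarrow>\<^sub>L real"
  assumes "is_norm N" "c > 0" and c: "\<And>x. c * norm x \<le> N x"
  shows "\<bar>L h\<bar> / N h \<le> norm L / c"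
proof (cases "h = 0")
  case False
  have "\<bar>L h\<bar> \<le> norm L * norm h" using norm_blinfun[of L h] by simp
  also have "\<dots> \<le> norm L * (N h / c)"
    using c[of h] assms(2) by (intro mult_left_mono) (auto simp: field_simps)
  finally show ?thesis using is_norm_pos[OF assms(1) False] by (simp add: field_simps)
qed (use assms is_norm_zero in auto)

lemma bilinear_form_bound:
  fixes B :: "(real^'n) \<Rightarrow>\<^sub>L (real^'n) \<Rightarrow>\<^sub>L real"
  assumes "is_norm N" "c > 0" and c: "\<And>x. c * norm x \<le> N x"
  shows "\<bar>B h h'\<bar> / (N h * N h') \<le> norm B / c / c"
proof (cases "h = 0")
  case False
  have pos: "N h > 0" using is_norm_pos[OF assms(1) False] .
  have "\<bar>B h h'\<bar> / (N h * N h') = \<bar>B h h'\<bar> / N h' / N h" by (simp add: mult.commute)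
  also have "\<dots> \<le> norm (B h) / c / N h"
    using linear_form_bound[OF assms, of "B h" h'] pos by (intro divide_right_mono) auto
  also have "\<dots> \<le> (norm B * (N h / c)) / c / N h"
  proof -
    have "norm (B h) \<le> norm B * norm h" by (rule norm_blinfun)
    also have "\<dots> \<le> norm B * (N h / c)"
      using c[of h] assms(2) by (intro mult_left_mono) (auto simp: field_simps)
    finally show ?thesis using pos assms(2) by (intro divide_right_mono) auto
  qed
  finally show ?thesis using pos by simp
qed (use assms is_norm_zero in auto)

lemma supnorm1_ge:
  fixes L :: "real^'n \<Rightarrow> (real^'n) \<Rightarrow>\<^sub>L real"
  assumes N: "is_norm N" and S: "compact S" "continuous_on S L" "P \<in> S"
  shows "\<bar>L P h\<bar> \<le> supnorm1 N S L * N h"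
proof (cases "h = 0")
  case False
  obtain c where c: "c > 0" "\<And>x. c * norm x \<le> N x" using is_norm_lower[OF N] by blast
  have "bounded (L ` S)" using S compact_continuous_image compact_imp_bounded by blast
  then obtain K where K: "\<And>Q. Q \<in> S \<Longrightarrow> norm (L Q) \<le> K" unfolding bounded_iff by blast
  have "opnorm1 N (L Q) \<le> K / c" if "Q \<in> S" for Q
    unfolding opnorm1_def
  proof (rule cSUP_least)
    fix k :: "real^'n"
    have "\<bar>L Q k\<bar> / N k \<le> norm (L Q) / c" by (rule linear_form_bound[OF N c])
    also have "\<dots> \<le> K / c" using K[OF that] c(1) by (simp add: divide_right_mono)
    finally show "\<bar>L Q k\<bar> / N k \<le> K / c" .
  qed (use False in blast)
  then have bdd: "bdd_above ((\<lambda>Q. opnorm1 N (L Q)) ` S)" by (rule bdd_aboveI2)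
  have "\<bar>L P h\<bar> / N h \<le> opnorm1 N (L P)"
    unfolding opnorm1_def
    by (rule cSUP_upper) (use False in \<open>auto intro!: bdd_aboveI2 linear_form_bound[OF N c]\<close>)
  also have "\<dots> \<le> supnorm1 N S L"
    using cSUP_upper[OF S(3) bdd] S(1) by (simp add: supnorm1_def compact_imp_closed)
  finally show ?thesis using is_norm_pos[OF N False] by (simp add: field_simps)
qed (simp add: is_norm_zero[OF N])

lemma supnorm2_ge:
  fixes B :: "real^'n \<Rightarrow> (real^'n) \<Rightarrow>\<^sub>L (real^'n) \<Rightarrow>\<^sub>L real"
  assumes N: "is_norm N" and S: "compact S" "continuous_on S B" "P \<in> S"
  shows "\<bar>B P h h'\<bar> \<le> supnorm2 N S B * (N h * N h')"
proof (cases "h = 0 \<or> h' = 0")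
  case False
  obtain c where c: "c > 0" "\<And>x. c * norm x \<le> N x" using is_norm_lower[OF N] by blast
  have "bounded (B ` S)" using S compact_continuous_image compact_imp_bounded by blast
  then obtain K where K: "\<And>Q. Q \<in> S \<Longrightarrow> norm (B Q) \<le> K" unfolding bounded_iff by blast
  let ?H = "{h :: real^'n. h \<noteq> 0}"
  have op: "opnorm2 N (\<lambda>h h'. B Q h h') =
      (SUP x\<in>?H \<times> ?H. \<bar>B Q (fst x) (snd x)\<bar> / (N (fst x) * N (snd x)))" for Q
    by (simp add: opnorm2_def case_prod_beta)
  have "opnorm2 N (\<lambda>h h'. B Q h h') \<le> K / c / c" if "Q \<in> S" for Q
    unfolding op
  proof (rule cSUP_least)
    fix x :: "(real^'n) \<times> (real^'n)"
    have "\<bar>B Q (fst x) (snd x)\<bar> / (N (fst x) * N (snd x)) \<le> norm (B Q) / c / c"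
      by (rule bilinear_form_bound[OF N c])
    also have "\<dots> \<le> K / c / c" using K[OF that] c(1) by (simp add: divide_right_mono)
    finally show "\<bar>B Q (fst x) (snd x)\<bar> / (N (fst x) * N (snd x)) \<le> K / c / c" .
  qed (use False in blast)
  then have bdd: "bdd_above ((\<lambda>Q. opnorm2 N (\<lambda>h h'. B Q h h')) ` S)" by (rule bdd_aboveI2)
  have "\<bar>B P (fst (h, h')) (snd (h, h'))\<bar> / (N (fst (h, h')) * N (snd (h, h')))
      \<le> opnorm2 N (\<lambda>h h'. B P h h')"
    unfolding op
    by (rule cSUP_upper)
       (use False in \<open>auto intro!: bdd_aboveI2 bilinear_form_bound[OF N c]\<close>)
  also have "\<dots> \<le> supnorm2 N S B"
    using cSUP_upper[OF S(3) bdd] S(1) by (simp add: supnorm2_def compact_imp_closed)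
  finally show ?thesis
    using False is_norm_pos[OF N, of h] is_norm_pos[OF N, of h'] by (simp add: field_simps)
qed (auto simp: is_norm_zero[OF N])

text \<open>A bound \<open>\<bar>t\<bar> \<le> M * N h\<close> at a single nonzero \<open>h\<close> already forces \<open>M \<ge> 0\<close>. The vector
  with all components one serves as \<open>h\<close>.\<close>

lemma supnorm1_nonneg:
  fixes L :: "real^'n \<Rightarrow> (real^'n) \<Rightarrow>\<^sub>L real"
  assumes "is_norm N" "compact S" "continuous_on S L" "P \<in> S"
  shows "supnorm1 N S L \<ge> 0"
proof -
  have "0 \<le> supnorm1 N S L * N (1 :: real^'n)"
    using supnorm1_ge[OF assms, of 1] by linarith
  then show ?thesis
    using is_norm_pos[OF assms(1), of 1] by (simp add: zero_le_mult_iff)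
qed

lemma supnorm2_nonneg:
  fixes B :: "real^'n \<Rightarrow> (real^'n) \<Rightarrow>\<^sub>L (real^'n) \<Rightarrow>\<^sub>L real"
  assumes "is_norm N" "compact S" "continuous_on S B" "P \<in> S"
  shows "supnorm2 N S B \<ge> 0"
proof -
  have "0 \<le> supnorm2 N S B * (N (1 :: real^'n) * N (1 :: real^'n))"
    using supnorm2_ge[OF assms, of 1 1] by linarith
  moreover have "N (1 :: real^'n) * N (1 :: real^'n) > 0"
    using is_norm_pos[OF assms(1), of 1] by simp
  ultimately show ?thesis by (meson leD mult_neg_pos not_le_imp_less)
qed

section \<open>Expansion along a segment\<close>

text \<open>Taylor's theorem with one-sided derivatives at the endpoints, where the function need not
  be defined beyond the interval. The derivative \<open>g'\<close> moves away from \<open>g' 0\<close> at speed at most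
  \<open>K\<close>, and integrating \<open>K t\<close> yields the factor one half; monotonicity of
  \<open>K t\<^sup>2 / 2 \<mp> (g t - t g' 0)\<close> replaces the integral.\<close>

lemma taylor_bound_unit_interval:
  fixes g g' g'' :: "real \<Rightarrow> real"
  assumes g: "\<And>t. t \<in> {0..1} \<Longrightarrow> (g has_real_derivative g' t) (at t within {0..1})"
    and g': "\<And>t. t \<in> {0..1} \<Longrightarrow> (g' has_real_derivative g'' t) (at t within {0..1})"
    and K: "\<And>t. t \<in> {0..1} \<Longrightarrow> \<bar>g'' t\<bar> \<le> K"
  shows "\<bar>g 1 - g 0 - g' 0\<bar> \<le> K / 2"
proof -
  have slope: "\<bar>g' t - g' 0\<bar> \<le> K * t" if "t \<in> {0..1}" for t
    using field_differentiable_bound[of "{0..1}" g' g'' K t 0] g' K that by simp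
  have gd: "(g has_real_derivative g' t) (at t)" if "0 < t" "t < 1" for t
    using g[of t] that at_within_Icc_at[of 0 t 1] by simp
  have cont: "continuous_on {0..1} g" using g by (meson DERIV_continuous_on)
  have one_sided: "s * (g 1 - g 0 - g' 0) \<le> K / 2" if s: "s = 1 \<or> s = -1" for s :: real
  proof -
    define f where "f t = K / 2 * t\<^sup>2 - s * (g t - t * g' 0)" for t
    have "f 0 \<le> f 1"
    proof (rule DERIV_nonneg_imp_increasing_open[of 0 1 f])
      fix t :: real assume t: "0 < t" "t < 1"
      have "(f has_real_derivative K * t - s * (g' t - g' 0)) (at t)"
        unfolding f_def by (auto intro!: derivative_eq_intros gd t)
      moreover have "K * t - s * (g' t - g' 0) \<ge> 0" using slope[of t] t s by auto
      ultimately show "\<exists>y. (f has_real_derivative y) (at t) \<and> 0 \<le> y" by blast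
    next
      show "continuous_on {0..1} f" unfolding f_def by (intro continuous_intros cont)
    qed simp
    then show ?thesis by (simp add: f_def algebra_simps)
  qed
  show ?thesis using one_sided[of 1] one_sided[of "-1"] unfolding abs_le_iff by simp
qed

lemma has_derivative_along_segment:
  assumes "convex S" "P \<in> S" "Q \<in> S" "t \<in> {0..1}"
    and f: "\<And>x. x \<in> S \<Longrightarrow> (f has_derivative f' x) (at x within S)"
  shows "((\<lambda>t. f (P + t *\<^sub>R (Q - P))) has_derivative
    (\<lambda>s. f' (P + t *\<^sub>R (Q - P)) (s *\<^sub>R (Q - P)))) (at t within {0..1})"
proof -
  have seg: "P + r *\<^sub>R (Q - P) \<in> S" if "r \<in> {0..1}" for r
    using convexD_alt[OF assms(1-3), of r] that by (simp add: algebra_simps)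
  show ?thesis
    by (rule has_derivative_in_compose2[where t = S, OF f])
       (use seg assms(4) in \<open>auto intro!: derivative_eq_intros\<close>)
qed

lemma expansion_remainder_bound:
  fixes v :: "'a::real_normed_vector \<Rightarrow> real"
  assumes S: "convex S" "P \<in> S" "Q \<in> S"
    and v: "\<And>x. x \<in> S \<Longrightarrow> (v has_derivative blinfun_apply (Dv x)) (at x within S)"
    and Dv: "\<And>x. x \<in> S \<Longrightarrow> (Dv has_derivative blinfun_apply (D2v x)) (at x within S)"
    and K: "\<And>x. x \<in> S \<Longrightarrow> \<bar>D2v x (Q - P) (Q - P)\<bar> \<le> K"
  shows "\<bar>v Q - v P - Dv P (Q - P)\<bar> \<le> K / 2"
proof -
  define x where "x t = P + t *\<^sub>R (Q - P)" for t :: real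
  have seg: "x r \<in> S" if "r \<in> {0..1}" for r
    using convexD_alt[OF S, of r] that by (simp add: x_def algebra_simps)
  have "\<bar>v (x 1) - v (x 0) - Dv (x 0) (Q - P)\<bar> \<le> K / 2"
  proof (rule taylor_bound_unit_interval)
    fix t :: real assume t: "t \<in> {0..1}"
    show "((\<lambda>t. v (x t)) has_real_derivative Dv (x t) (Q - P)) (at t within {0..1})"
      using has_derivative_along_segment[OF S t v]
      by (simp add: x_def has_field_derivative_def blinfun.scaleR_right mult_commute_abs)
    have "((\<lambda>t. Dv (x t)) has_derivative (\<lambda>s. D2v (x t) (s *\<^sub>R (Q - P)))) (at t within {0..1})"
      using has_derivative_along_segment[OF S t Dv] by (simp add: x_def)
    then have "((\<lambda>t. Dv (x t) (Q - P)) has_derivative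
        (\<lambda>s. D2v (x t) (s *\<^sub>R (Q - P)) (Q - P))) (at t within {0..1})"
      by (rule blinfun.FDERIV[THEN has_derivative_eq_rhs, OF _ has_derivative_const]) simp
    then show "((\<lambda>t. Dv (x t) (Q - P)) has_real_derivative D2v (x t) (Q - P) (Q - P))
        (at t within {0..1})"
      by (simp add: has_field_derivative_def blinfun.scaleR_right blinfun.scaleR_left mult_commute_abs)
    show "\<bar>D2v (x t) (Q - P) (Q - P)\<bar> \<le> K" using K seg t by blast
  qed
  then show ?thesis by (simp add: x_def)
qed

lemma increment_bound:
  fixes v :: "'a::real_normed_vector \<Rightarrow> real"
  assumes S: "convex S" "P \<in> S" "Q \<in> S"
    and v: "\<And>x. x \<in> S \<Longrightarrow> (v has_derivative blinfun_apply (Dv x)) (at x within S)"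
    and K: "\<And>x. x \<in> S \<Longrightarrow> \<bar>Dv x (Q - P)\<bar> \<le> K"
  shows "\<bar>v Q - v P\<bar> \<le> K"
proof -
  define x where "x t = P + t *\<^sub>R (Q - P)" for t :: real
  have seg: "x r \<in> S" if "r \<in> {0..1}" for r
    using convexD_alt[OF S, of r] that by (simp add: x_def algebra_simps)
  have d: "((\<lambda>t. v (x t)) has_real_derivative Dv (x t) (Q - P)) (at t within {0..1})"
    if "t \<in> {0..1}" for t
    using has_derivative_along_segment[OF S that v]
    by (simp add: x_def has_field_derivative_def blinfun.scaleR_right mult_commute_abs)
  have "norm (v (x 1) - v (x 0)) \<le> K * norm (1 - 0 :: real)"
    by (rule field_differentiable_bound[of "{0..1}", OF _ d]) (use K seg in auto)
  then show ?thesis by (simp add: x_def)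
qed

section \<open>Barycentric coordinates and the estimates\<close>

lemma barycentric_coordinates_unique:
  fixes A :: "'i \<Rightarrow> 'a::real_vector"
  assumes "finite I" "inj_on A I" "\<not> affine_dependent (A ` I)"
    and "(\<Sum>j\<in>I. l j *\<^sub>R A j) = (\<Sum>j\<in>I. l' j *\<^sub>R A j)" "sum l I = sum l' I" "i \<in> I"
  shows "l i = l' i"
proof (rule ccontr)
  assume ne: "l i \<noteq> l' i"
  \<comment> \<open>the difference of the coordinates, carried over from indices to vertices\<close>
  define U where "U x = l (the_inv_into I A x) - l' (the_inv_into I A x)" for x
  have U: "U (A j) = l j - l' j" if "j \<in> I" for j
    using that assms(2) by (simp add: U_def the_inv_into_f_f)
  have "sum U (A ` I) = (\<Sum>j\<in>I. l j - l' j)"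
    using assms(2) U by (simp add: sum.reindex)
  then have "sum U (A ` I) = 0" using assms(5) by (simp add: sum_subtractf)
  moreover have "(\<Sum>x\<in>A ` I. U x *\<^sub>R x) = (\<Sum>j\<in>I. (l j - l' j) *\<^sub>R A j)"
    using assms(2) U by (simp add: sum.reindex)
  then have "(\<Sum>x\<in>A ` I. U x *\<^sub>R x) = 0"
    using assms(4) by (simp add: scaleR_left_diff_distrib sum_subtractf)
  moreover have "\<exists>x\<in>A ` I. U x \<noteq> 0" using U[OF assms(6)] ne assms(6) by (intro bexI[of _ "A i"]) auto
  ultimately show False
    using assms(1,3) by (subst (asm) affine_dependent_explicit_finite) auto
qed

text \<open>A point of the convex hull has some nonnegative coordinates, and these are the chosen ones
  because coordinates with respect to affinely independent points are unique.\<close>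

lemma barycentric_in_simplex:
  fixes A :: "nat \<Rightarrow> real^'n"
  assumes "simplex_vertices A" "P \<in> convex hull (A ` {1..CARD('n) + 1})"
  shows "\<And>i. i \<in> {1..CARD('n) + 1} \<Longrightarrow> barycentric A i P \<ge> 0"
    and "(\<Sum>i = 1..CARD('n) + 1. barycentric A i P) = 1"
    and "(\<Sum>i = 1..CARD('n) + 1. barycentric A i P *\<^sub>R A i) = P"
proof -
  let ?I = "{1..CARD('n) + 1}"
  have inj: "inj_on A ?I" and indep: "\<not> affine_dependent (A ` ?I)"
    using assms(1) unfolding simplex_vertices_def by blast+
  define Coord where "Coord l \<longleftrightarrow> (\<Sum>j\<in>?I. l j *\<^sub>R A j) = P \<and> sum l ?I = 1" for l
  obtain u where u: "\<forall>x\<in>A ` ?I. 0 \<le> u x" "sum u (A ` ?I) = 1" "(\<Sum>x\<in>A ` ?I. u x *\<^sub>R x) = P"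
    using assms(2) by (subst (asm) convex_hull_finite) auto
  define l where "l = u \<circ> A"
  have l: "Coord l"
    using u(2,3) inj unfolding Coord_def l_def by (simp add: sum.reindex)
  have bary: "(\<lambda>i. barycentric A i P) = (SOME l. Coord l)"
    unfolding barycentric_def Coord_def by simp
  have c: "Coord (\<lambda>i. barycentric A i P)"
    unfolding bary by (rule someI[of Coord, OF l])
  then show "(\<Sum>i\<in>?I. barycentric A i P) = 1" "(\<Sum>i\<in>?I. barycentric A i P *\<^sub>R A i) = P"
    unfolding Coord_def by blast+
  fix i assume i: "i \<in> ?I"
  have "barycentric A i P = l i"
    using barycentric_coordinates_unique[OF _ inj indep _ _ i, of "\<lambda>i. barycentric A i P" l] c l
    unfolding Coord_def by simp
  then show "barycentric A i P \<ge> 0" using u(1) i by (simp add: l_def)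
qed

text \<open>The linear form \<open>L\<close> is free: affine interpolation reproduces it, so it may be chosen to
  shrink the increments. Zero suits the mean value bound and \<open>Dv(P)\<close> the Taylor bound.\<close>

lemma interpolation_error_bound:
  fixes A :: "nat \<Rightarrow> real^'n" and L :: "(real^'n) \<Rightarrow>\<^sub>L real"
  assumes "simplex_vertices A" "P \<in> convex hull (A ` {1..CARD('n) + 1})"
    and E: "\<And>i. i \<in> {1..CARD('n) + 1} \<Longrightarrow> \<bar>v (A i) - v P - L (A i - P)\<bar> \<le> E"
  shows "\<bar>interpolant A v P - v P\<bar> \<le> E"
proof -
  let ?I = "{1..CARD('n) + 1}"
  let ?b = "\<lambda>i. barycentric A i P"
  note b = barycentric_in_simplex[OF assms(1,2)]
  have "(\<Sum>i\<in>?I. ?b i * L (A i - P)) = L (\<Sum>i\<in>?I. ?b i *\<^sub>R (A i - P))"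
    by (simp only: blinfun.sum_right blinfun.scaleR_right real_scaleR_def)
  also have "(\<Sum>i\<in>?I. ?b i *\<^sub>R (A i - P)) = P - P"
    unfolding scaleR_diff_right sum_subtractf b(3) scaleR_left.sum[symmetric] b(2) by simp
  finally have lin: "(\<Sum>i\<in>?I. ?b i * L (A i - P)) = 0" by simp
  have const: "(\<Sum>i\<in>?I. ?b i * v P) = v P"
    unfolding sum_distrib_right[symmetric] b(2) by simp
  have "interpolant A v P - v P = (\<Sum>i\<in>?I. ?b i * (v (A i) - v P - L (A i - P)))"
    unfolding right_diff_distrib sum_subtractf lin const interpolant_def by simp
  also have "\<bar>\<dots>\<bar> \<le> (\<Sum>i\<in>?I. \<bar>?b i * (v (A i) - v P - L (A i - P))\<bar>)"
    by (rule sum_abs)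
  also have "\<dots> \<le> (\<Sum>i\<in>?I. ?b i * E)"
    by (intro sum_mono) (use b(1) E in \<open>simp add: abs_mult mult_left_mono\<close>)
  also have "\<dots> = E"
    unfolding sum_distrib_right[symmetric] b(2) by simp
  finally show ?thesis .
qed

theorem lemma3p4:
  fixes N :: "real^'n \<Rightarrow> real"
    and A :: "nat \<Rightarrow> real^'n"
    and S :: "(real^'n) set"
    and v :: "real^'n \<Rightarrow> real"
    and Dv :: "real^'n \<Rightarrow> ((real^'n) \<Rightarrow>\<^sub>L real)"
    and D2v :: "real^'n \<Rightarrow> ((real^'n) \<Rightarrow>\<^sub>L ((real^'n) \<Rightarrow>\<^sub>L real))"
  assumes "CARD('n) > 1"
    and "is_norm N"
    and "simplex_vertices A"
    and "S = convex hull (A ` {1..CARD('n) + 1})"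
    and "C2_on S v Dv D2v"
  shows "(\<forall>P\<in>S. \<bar>interpolant A v P - v P\<bar> \<le> supnorm2 N S D2v / 2 * (diam N S)\<^sup>2) \<and>
         (\<forall>P\<in>S. \<bar>interpolant A v P - v P\<bar> \<le>
            supnorm1 N S Dv / 2 * diam N S + supnorm2 N S D2v / 4 * (diam N S)\<^sup>2)"
proof -
  let ?I = "{1..CARD('n) + 1}"
  let ?d = "diam N S"
  let ?M1 = "supnorm1 N S Dv" and ?M2 = "supnorm2 N S D2v"
  note N = assms(2)
  have nn: "N x \<ge> 0" for x using N unfolding is_norm_def by blast
  have conv: "convex S" and comp: "compact S"
    using assms(4) by (auto intro: finite_imp_compact_convex_hull)
  have v: "\<And>x. x \<in> S \<Longrightarrow> (v has_derivative Dv x) (at x within S)"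
    and Dv: "\<And>x. x \<in> S \<Longrightarrow> (Dv has_derivative D2v x) (at x within S)"
    and cont2: "continuous_on S D2v"
    using assms(5) unfolding C2_on_def by blast+
  have cont1: "continuous_on S Dv" using Dv by (rule has_derivative_continuous_on)
  have A: "A i \<in> S" if "i \<in> ?I" for i
    using that assms(4) by (auto intro: hull_inc)
  have both: "\<bar>interpolant A v P - v P\<bar> \<le> ?M2 * ?d\<^sup>2 / 2 \<and>
      \<bar>interpolant A v P - v P\<bar> \<le> ?M1 * ?d" if P: "P \<in> S" for P
  proof
    have PS: "P \<in> convex hull (A ` ?I)" using P assms(4) by simp
    have M1: "?M1 \<ge> 0" by (rule supnorm1_nonneg[OF N comp cont1 P])
    have M2: "?M2 \<ge> 0" by (rule supnorm2_nonneg[OF N comp cont2 P])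
    have d: "N (A i - P) \<le> ?d" if "i \<in> ?I" for i
      by (rule diam_ge[OF N comp A[OF that] P])
    show "\<bar>interpolant A v P - v P\<bar> \<le> ?M2 * ?d\<^sup>2 / 2"
    proof (rule interpolation_error_bound[OF assms(3) PS, where L = "Dv P"])
      fix i assume i: "i \<in> ?I"
      show "\<bar>v (A i) - v P - Dv P (A i - P)\<bar> \<le> ?M2 * ?d\<^sup>2 / 2"
      proof (rule expansion_remainder_bound[OF conv P A[OF i] v Dv])
        fix x assume x: "x \<in> S"
        have "\<bar>D2v x (A i - P) (A i - P)\<bar> \<le> ?M2 * (N (A i - P) * N (A i - P))"
          by (rule supnorm2_ge[OF N comp cont2 x])
        also have "\<dots> \<le> ?M2 * ?d\<^sup>2"
          unfolding power2_eq_square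
          using d[OF i] nn[of "A i - P"] M2 by (intro mult_left_mono mult_mono) linarith+
        finally show "\<bar>D2v x (A i - P) (A i - P)\<bar> \<le> ?M2 * ?d\<^sup>2" .
      qed
    qed
    show "\<bar>interpolant A v P - v P\<bar> \<le> ?M1 * ?d"
    proof (rule interpolation_error_bound[OF assms(3) PS, where L = 0])
      fix i assume i: "i \<in> ?I"
      have "\<bar>v (A i) - v P\<bar> \<le> ?M1 * ?d"
      proof (rule increment_bound[OF conv P A[OF i] v])
        fix x assume x: "x \<in> S"
        have "\<bar>Dv x (A i - P)\<bar> \<le> ?M1 * N (A i - P)"
          by (rule supnorm1_ge[OF N comp cont1 x])
        also have "\<dots> \<le> ?M1 * ?d" using d[OF i] M1 by (rule mult_left_mono)
        finally show "\<bar>Dv x (A i - P)\<bar> \<le> ?M1 * ?d" .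
      qed
      then show "\<bar>v (A i) - v P - blinfun_apply 0 (A i - P)\<bar> \<le> ?M1 * ?d" by simp
    qed
  qed
  show ?thesis
  proof (intro conjI ballI)
    fix P assume "P \<in> S"
    from both[OF this] have
      b2: "\<bar>interpolant A v P - v P\<bar> \<le> ?M2 * ?d\<^sup>2 / 2" and
      b1: "\<bar>interpolant A v P - v P\<bar> \<le> ?M1 * ?d" by blast+
    show "\<bar>interpolant A v P - v P\<bar> \<le> ?M2 / 2 * ?d\<^sup>2" using b2 by simp
    show "\<bar>interpolant A v P - v P\<bar> \<le> ?M1 / 2 * ?d + ?M2 / 4 * ?d\<^sup>2"
      using b1 b2 by (simp add: field_simps)
  qed
qed

end
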